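(* Let $n$ be a positive integer and let $P_1, P_2 \subseteq \mathbb{Z}_n$ be pitch class sets. Then the weighted graphs $G(P_1)$ and $G(P_2)$ are isomorphic if and only if $P_1 \sim_{T/I} P_2$.
   Context: Elements of $\mathbb{Z}_n$ are represented by integers in $\{0,\ldots,n-1\}$. A pitch class set is a subset $P \subseteq \mathbb{Z}_n$. The interval class is $\mathrm{ic}(p,q) = \min(|p-q|,\ n-|p-q|)$, computed with these representatives. The pitch class graph $G(P)$ is the complete weighted graph with vertex set $P$ in which each unordered pair $\{p,q\}$ of distinct elements of $P$ has weight $\mathrm{ic}(p,q)$. An isomorphism of weighted graphs $G(P_1) \to G(P_2)$ is a bijection $\varphi: P_1 \to P_2$ with $\mathrm{ic}(\varphi(p),\varphi(q)) = \mathrm{ic}(p,q)$ for all distinct $p,q \in P_1$. The dihedral group $D_n$ acts on $\mathbb{Z}_n$ by transpositions $T_s(p) = p+s$ and inversions $I_s(p) = s-p$ (mod $n$), $s \in \mathbb{Z}_n$. Two sets are T/I-equivalent, written $P_1 \sim_{T/I} P_2$, if $P_2 = g(P_1)$ for some $g \in D_n$. *)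

theory Defs
  imports Main
begin

definition Zn :: "nat \<Rightarrow> int set" where
  "Zn n = {0..<int n}"

text \<open>
  The interval class is computed with the representatives \<^term>\<open>p\<close> and \<^term>\<open>q\<close>
  themselves, so it is meaningful only for arguments in \<^term>\<open>Zn n\<close>.
\<close>

definition ic :: "nat \<Rightarrow> int \<Rightarrow> int \<Rightarrow> int" where
  "ic n p q = min \<bar>p - q\<bar> (int n - \<bar>p - q\<bar>)"

lemma ic_commute: "ic n p q = ic n q p"
  by (simp add: ic_def abs_minus_commute)

text \<open>
  In a complete weighted graph every unordered pair of distinct vertices is an edge, so
  the edge set is not recorded. The weight of the edge joining distinct vertices \<open>p\<close> and
  \<open>q\<close> is \<open>weight G p q\<close>, a function meant to be symmetric; values at equal arguments or
  outside the vertex set carry no meaning, and isomorphisms ignore them.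
\<close>

record ('v, 'w) complete_wgraph =
  verts :: "'v set"
  weight :: "'v \<Rightarrow> 'v \<Rightarrow> 'w"

definition wgraph_iso ::
  "('a, 'w) complete_wgraph \<Rightarrow> ('b, 'w) complete_wgraph \<Rightarrow> ('a \<Rightarrow> 'b) \<Rightarrow> bool" where
  "wgraph_iso G H \<phi> \<longleftrightarrow>
     bij_betw \<phi> (verts G) (verts H) \<and>
     (\<forall>p\<in>verts G. \<forall>q\<in>verts G. p \<noteq> q \<longrightarrow> weight H (\<phi> p) (\<phi> q) = weight G p q)"

definition wgraph_isomorphic ::
  "('a, 'w) complete_wgraph \<Rightarrow> ('b, 'w) complete_wgraph \<Rightarrow> bool" where
  "wgraph_isomorphic G H \<longleftrightarrow> (\<exists>\<phi>. wgraph_iso G H \<phi>)"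

definition pc_graph :: "nat \<Rightarrow> int set \<Rightarrow> (int, int) complete_wgraph" where
  "pc_graph n P = \<lparr>verts = P, weight = ic n\<rparr>"

definition transposition :: "nat \<Rightarrow> int \<Rightarrow> int \<Rightarrow> int" where
  "transposition n s p = (p + s) mod int n"

definition inversion :: "nat \<Rightarrow> int \<Rightarrow> int \<Rightarrow> int" where
  "inversion n s p = (s - p) mod int n"

text \<open>
  The dihedral group, given by the maps through which it acts on \<^term>\<open>Zn n\<close>. For
  \<open>n \<le> 2\<close> the action is not faithful and some transpositions and inversions agree on
  \<^term>\<open>Zn n\<close>; this does not affect the orbits.
\<close>

definition dihedral_maps :: "nat \<Rightarrow> (int \<Rightarrow> int) set" where
  "dihedral_maps n = transposition n ` Zn n \<union> inversion n ` Zn n"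

definition TI_equiv :: "nat \<Rightarrow> int set \<Rightarrow> int set \<Rightarrow> bool" where
  "TI_equiv n P Q \<longleftrightarrow> (\<exists>g\<in>dihedral_maps n. Q = g ` P)"

end

theory Submission
  imports Defs
begin

text \<open>
  The interval class of \<open>p\<close> and \<open>q\<close> is the residue of \<open>p - q\<close> modulo \<open>n\<close> up to sign
  (\<open>ic_eq_iff_dvd\<close>), so a map preserves interval classes exactly when it preserves every
  difference modulo \<open>n\<close> up to a sign that may depend on the pair. Transpositions
  preserve all differences and inversions negate them all, which makes both of them
  isomorphisms.

  For the converse the point is that a single sign serves for all differences from a
  base point, because two points with conflicting signs would leave no possible sign for
  the difference between them (\<open>differences_preserved_or_negated\<close>). Hence an isomorphism
  coincides on \<open>P1\<close> with a transposition or with an inversion, and this element of the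
  dihedral group carries \<open>P1\<close> to \<open>P2\<close>.
\<close>

text \<open>
  Representatives differ by less than \<open>n\<close> in absolute value. So if two differences of
  representatives have a sum or difference divisible by \<open>n\<close>, that sum or difference is
  \<open>0\<close> or \<open>\<plusminus>n\<close>; zero means that the two absolute values agree, and \<open>\<plusminus>n\<close>
  that they add up to \<open>n\<close>, which is what equality of the two minima says.
\<close>

lemma ic_eq_iff_dvd:
  assumes "p \<in> Zn n" "q \<in> Zn n" "p' \<in> Zn n" "q' \<in> Zn n"
  shows "ic n p' q' = ic n p q \<longleftrightarrow>
    int n dvd (p' - q') - (p - q) \<or> int n dvd (p' - q') + (p - q)"
proof -
  define d d' where "d = p - q" and "d' = p' - q'"
  have bounds: "\<bar>d\<bar> < int n" "\<bar>d'\<bar> < int n"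
    using assms by (auto simp: Zn_def d_def d'_def)
  have dvd_iff: "int n dvd x \<longleftrightarrow> x = 0 \<or> x = int n \<or> x = - int n"
    if "\<bar>x\<bar> < 2 * int n" for x
  proof
    assume "int n dvd x"
    then obtain k where k: "x = int n * k" ..
    have "int n * \<bar>k\<bar> < int n * 2"
      using that by (simp add: k abs_mult mult.commute)
    then have "\<bar>k\<bar> < 2"
      by (simp add: mult_less_cancel_left)
    then have "k = -1 \<or> k = 0 \<or> k = 1" by arith
    then show "x = 0 \<or> x = int n \<or> x = - int n" using k by auto
  qed auto
  have "\<bar>d' - d\<bar> < 2 * int n" "\<bar>d' + d\<bar> < 2 * int n"
    using bounds by linarith+
  then have "int n dvd d' - d \<or> int n dvd d' + d \<longleftrightarrow>
      (d' - d = 0 \<or> d' - d = int n \<or> d' - d = - int n) \<or>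
      (d' + d = 0 \<or> d' + d = int n \<or> d' + d = - int n)"
    by (simp only: dvd_iff)
  also have "\<dots> \<longleftrightarrow> min \<bar>d'\<bar> (int n - \<bar>d'\<bar>) = min \<bar>d\<bar> (int n - \<bar>d\<bar>)"
    using bounds by (auto simp: min_def abs_if split: if_splits)
  finally show ?thesis by (simp add: ic_def d_def d'_def)
qed

text \<open>
  Differences are additive, so signs propagate along triangles. Suppose that negation
  fails at \<open>a\<close> and preservation fails at \<open>b\<close>, both relative to the base point \<open>p0\<close>. Then
  the difference \<open>a - p0\<close> is preserved and \<open>b - p0\<close> is negated. If \<open>b - a\<close> is preserved,
  adding \<open>a - p0\<close> shows that \<open>b - p0\<close> is preserved; if \<open>b - a\<close> is negated, subtracting it
  from \<open>b - p0\<close> shows that \<open>a - p0\<close> is negated. Both are excluded. Arguing with failures,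
  rather than with a sign chosen for each point, copes with differences of order \<open>2\<close>
  modulo \<open>m\<close>, for which both signs are correct.
\<close>

lemma differences_preserved_or_negated:
  fixes m :: int
  assumes p0: "p0 \<in> P"
    and up_to_sign: "\<And>p q. p \<in> P \<Longrightarrow> q \<in> P \<Longrightarrow>
      m dvd (\<phi> p - \<phi> q) - (p - q) \<or> m dvd (\<phi> p - \<phi> q) + (p - q)"
  shows "(\<forall>p\<in>P. m dvd (\<phi> p - \<phi> p0) - (p - p0)) \<or>
    (\<forall>p\<in>P. m dvd (\<phi> p - \<phi> p0) + (p - p0))"
proof (rule ccontr)
  assume "\<not> ?thesis"
  then obtain a b where a: "a \<in> P" "\<not> m dvd (\<phi> a - \<phi> p0) + (a - p0)"
    and b: "b \<in> P" "\<not> m dvd (\<phi> b - \<phi> p0) - (b - p0)"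
    by blast
  have a_plus: "m dvd (\<phi> a - \<phi> p0) - (a - p0)"
    using up_to_sign[OF a(1) p0] a(2) by blast
  have b_minus: "m dvd (\<phi> b - \<phi> p0) + (b - p0)"
    using up_to_sign[OF b(1) p0] b(2) by blast
  from up_to_sign[OF b(1) a(1)] show False
  proof
    assume "m dvd (\<phi> b - \<phi> a) - (b - a)"
    from dvd_add[OF this a_plus] have "m dvd (\<phi> b - \<phi> p0) - (b - p0)"
      by (simp add: algebra_simps)
    with b(2) show False by contradiction
  next
    assume "m dvd (\<phi> b - \<phi> a) + (b - a)"
    from dvd_diff[OF b_minus this] have "m dvd (\<phi> a - \<phi> p0) + (a - p0)"
      by (simp add: algebra_simps)
    with a(2) show False by contradiction
  qed
qed

lemma dihedral_maps_in_Zn: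
  assumes "n > 0" "g \<in> dihedral_maps n"
  shows "g p \<in> Zn n"
  using assms by (auto simp: dihedral_maps_def transposition_def inversion_def Zn_def)

lemma dihedral_maps_preserve_ic:
  assumes "n > 0" "g \<in> dihedral_maps n" "p \<in> Zn n" "q \<in> Zn n"
  shows "ic n (g p) (g q) = ic n p q"
proof -
  have mod_diff: "int n dvd (x mod int n - y mod int n) - (x - y)" for x y :: int
    by (metis dvd_refl mod_diff_eq mod_eq_dvd_iff)
  from assms(2) consider s where "g = transposition n s" | s where "g = inversion n s"
    by (auto simp: dihedral_maps_def)
  then have "int n dvd (g p - g q) - (p - q) \<or> int n dvd (g p - g q) + (p - q)"
  proof cases
    case 1
    then show ?thesis
      using mod_diff[of "p + s" "q + s"] by (simp add: transposition_def)
  next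
    case 2
    then show ?thesis
      using mod_diff[of "s - p" "s - q"] by (simp add: inversion_def algebra_simps)
  qed
  then show ?thesis
    using assms by (simp add: ic_eq_iff_dvd dihedral_maps_in_Zn)
qed

text \<open>
  An image under \<open>g\<close> determines its argument because distinct representatives have
  positive interval class.
\<close>

lemma dihedral_maps_inj_on_Zn:
  assumes "n > 0" "g \<in> dihedral_maps n"
  shows "inj_on g (Zn n)"
proof (rule inj_onI)
  fix p q assume pq: "p \<in> Zn n" "q \<in> Zn n" and "g p = g q"
  then have "ic n p q = ic n (g p) (g p)"
    using dihedral_maps_preserve_ic[OF assms pq] by simp
  also have "\<dots> = 0" by (simp add: ic_def)
  finally show "p = q"
    using pq by (auto simp: ic_def Zn_def min_def split: if_splits)
qed

text \<open>
  The group element is read off at the base point: it has to send \<open>p0\<close> to \<open>\<phi> p0\<close>, so its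
  parameter is \<open>\<phi> p0 - p0\<close> for a transposition and \<open>\<phi> p0 + p0\<close> for an inversion.
\<close>

lemma ic_preserving_map_is_dihedral:
  assumes n: "n > 0" and P: "P \<subseteq> Zn n" and maps: "\<And>p. p \<in> P \<Longrightarrow> \<phi> p \<in> Zn n"
    and pres: "\<And>p q. p \<in> P \<Longrightarrow> q \<in> P \<Longrightarrow> p \<noteq> q \<Longrightarrow> ic n (\<phi> p) (\<phi> q) = ic n p q"
  shows "\<exists>g\<in>dihedral_maps n. \<forall>p\<in>P. \<phi> p = g p"
proof (cases "P = {}")
  case True
  have "transposition n 0 \<in> dihedral_maps n"
    using n by (simp add: dihedral_maps_def Zn_def)
  with True show ?thesis by blast
next
  case False
  then obtain p0 where p0: "p0 \<in> P" by blast
  have residue: "\<phi> p = x mod int n" if "p \<in> P" "int n dvd \<phi> p - x" for p x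
  proof -
    have "\<phi> p mod int n = x mod int n"
      using that(2) by (simp add: mod_eq_dvd_iff)
    then show ?thesis using maps[OF that(1)] by (simp add: Zn_def)
  qed
  have "int n dvd (\<phi> p - \<phi> q) - (p - q) \<or> int n dvd (\<phi> p - \<phi> q) + (p - q)"
    if "p \<in> P" "q \<in> P" for p q
  proof (cases "p = q")
    case False
    have "p \<in> Zn n" "q \<in> Zn n" using that P by auto
    with pres[OF that False] show ?thesis
      using ic_eq_iff_dvd maps that by blast
  qed simp
  from differences_preserved_or_negated[of p0 P "int n" \<phi>, OF p0 this]
  show ?thesis
  proof
    assume *: "\<forall>p\<in>P. int n dvd (\<phi> p - \<phi> p0) - (p - p0)"
    let ?s = "(\<phi> p0 - p0) mod int n"
    have "\<phi> p = transposition n ?s p" if "p \<in> P" for p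
      using residue[OF that, of "p + (\<phi> p0 - p0)"] * that
      by (simp add: transposition_def mod_simps algebra_simps)
    moreover have "transposition n ?s \<in> dihedral_maps n"
      using n by (simp add: dihedral_maps_def Zn_def)
    ultimately show ?thesis by blast
  next
    assume *: "\<forall>p\<in>P. int n dvd (\<phi> p - \<phi> p0) + (p - p0)"
    let ?s = "(\<phi> p0 + p0) mod int n"
    have "\<phi> p = inversion n ?s p" if "p \<in> P" for p
      using residue[OF that, of "(\<phi> p0 + p0) - p"] * that
      by (simp add: inversion_def mod_simps algebra_simps)
    moreover have "inversion n ?s \<in> dihedral_maps n"
      using n by (simp add: dihedral_maps_def Zn_def)
    ultimately show ?thesis by blast
  qed
qed

theorem lemma2p1:
  fixes n :: nat and P1 P2 :: "int set"
  assumes "n > 0" and "P1 \<subseteq> Zn n" and "P2 \<subseteq> Zn n"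
  shows "wgraph_isomorphic (pc_graph n P1) (pc_graph n P2) \<longleftrightarrow> TI_equiv n P1 P2"
proof
  assume "wgraph_isomorphic (pc_graph n P1) (pc_graph n P2)"
  then obtain \<phi> where bij: "bij_betw \<phi> P1 P2"
    and pres: "\<And>p q. p \<in> P1 \<Longrightarrow> q \<in> P1 \<Longrightarrow> p \<noteq> q \<Longrightarrow> ic n (\<phi> p) (\<phi> q) = ic n p q"
    by (auto simp: wgraph_isomorphic_def wgraph_iso_def pc_graph_def)
  have "\<phi> p \<in> Zn n" if "p \<in> P1" for p
    using bij_betwE[OF bij] that assms(3) by blast
  from ic_preserving_map_is_dihedral[of n P1 \<phi>, OF assms(1,2) this pres]
  obtain g where "g \<in> dihedral_maps n" "\<forall>p\<in>P1. \<phi> p = g p" by blast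
  moreover from this(2) have "P2 = g ` P1"
    using bij_betw_imp_surj_on[OF bij] by force
  ultimately show "TI_equiv n P1 P2"
    by (auto simp: TI_equiv_def)
next
  assume "TI_equiv n P1 P2"
  then obtain g where g: "g \<in> dihedral_maps n" and P2: "P2 = g ` P1"
    by (auto simp: TI_equiv_def)
  have "bij_betw g P1 P2"
    using inj_on_subset[OF dihedral_maps_inj_on_Zn[OF assms(1) g] assms(2)] P2
    by (simp add: bij_betw_def)
  moreover have "ic n (g p) (g q) = ic n p q" if "p \<in> P1" "q \<in> P1" for p q
    using dihedral_maps_preserve_ic[OF assms(1) g] that assms(2) by blast
  ultimately show "wgraph_isomorphic (pc_graph n P1) (pc_graph n P2)"
    by (auto simp: wgraph_isomorphic_def wgraph_iso_def pc_graph_def)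
qed

end
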